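(* Let $K$ be an algebraically closed field and let $P\subseteq\mathrm{GL}_n(K)$ be the upper-block parabolic subgroup of block sizes $(b_1,\dots,b_p)$, with $b_i\ge1$ and $b_1+\dots+b_p=n$. Let $L_P$ be its Levi subgroup and $\mathfrak{n}_{\mathfrak{p}}$ the nilradical of $\mathfrak{p}=\mathrm{Lie}(P)$. Then $L_P$ acts by conjugation with finitely many orbits on $\mathfrak{n}_{\mathfrak{p}}$ if and only if $p\in\{1,2\}$, that is, if and only if $P$ has at most two blocks.
   Context: $P$ is the group of invertible block upper triangular matrices with diagonal blocks of sizes $b_1,\dots,b_p$; $L_P\cong\prod_i\mathrm{GL}_{b_i}(K)$ is the subgroup of block diagonal matrices in $P$; $\mathfrak{n}_{\mathfrak{p}}$ is the space of strictly block upper triangular matrices (zero diagonal blocks). *)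

theory Defs
  imports
    "Jordan_Normal_Form.Matrix"
    "HOL-Algebra.Group_Action"
    "HOL-Computational_Algebra.Polynomial"
begin

definition GL :: "nat \<Rightarrow> 'a::field mat monoid" where
  "GL n = units_of (ring_mat TYPE('a) n ())"

(* Indices of matrices and of blocks both start at 0: block_index bs i is the block that
   contains row (or column) i, for i < sum_list bs. *)
fun block_index :: "nat list \<Rightarrow> nat \<Rightarrow> nat" where
  "block_index [] i = 0"
| "block_index (b # bs) i = (if i < b then 0 else Suc (block_index bs (i - b)))"

definition parabolic_lie :: "nat \<Rightarrow> nat list \<Rightarrow> 'a::field mat set" where
  "parabolic_lie n bs = {A \<in> carrier_mat n n.
     \<forall>i<n. \<forall>j<n. block_index bs i > block_index bs j \<longrightarrow> A $$ (i, j) = 0}"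

definition parabolic :: "nat \<Rightarrow> nat list \<Rightarrow> 'a::field mat set" where
  "parabolic n bs = carrier (GL n) \<inter> parabolic_lie n bs"

definition levi :: "nat \<Rightarrow> nat list \<Rightarrow> 'a::field mat set" where
  "levi n bs = {g \<in> parabolic n bs.
     \<forall>i<n. \<forall>j<n. block_index bs i \<noteq> block_index bs j \<longrightarrow> g $$ (i, j) = 0}"

abbreviation levi_group :: "nat \<Rightarrow> nat list \<Rightarrow> 'a::field mat monoid" where
  "levi_group n bs \<equiv> GL n\<lparr>carrier := levi n bs\<rparr>"

(* The strictly block upper triangular matrices, i.e. the Lie algebra of the unipotent radical
   of P. The largest nilpotent ideal of the Lie algebra of P is bigger: it contains the scalar
   matrices. *)
definition nilradical :: "nat \<Rightarrow> nat list \<Rightarrow> 'a::field mat set" where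
  "nilradical n bs = {A \<in> parabolic_lie n bs.
     \<forall>i<n. \<forall>j<n. block_index bs i = block_index bs j \<longrightarrow> A $$ (i, j) = 0}"

(* The restriction to E makes each map extensional, as the locale group_action requires. *)
definition conj_on :: "nat \<Rightarrow> 'a::field mat set \<Rightarrow> 'a mat \<Rightarrow> 'a mat \<Rightarrow> 'a mat" where
  "conj_on n E g = (\<lambda>A\<in>E. g * A * inv\<^bsub>GL n\<^esub> g)"

lemma group_GL: "group (GL n :: 'a::field mat monoid)"
proof -
  interpret ring "ring_mat TYPE('a) n ()" by (rule ring_mat)
  show ?thesis unfolding GL_def by (rule units_group)
qed

lemma carrier_GL: "g \<in> carrier (GL n) \<Longrightarrow> g \<in> carrier_mat n n"
  by (auto simp: GL_def units_of_def Units_def ring_mat_def)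

lemma mult_GL: "x \<otimes>\<^bsub>GL n\<^esub> y = x * y"
  by (simp add: GL_def units_of_def ring_mat_def)

lemma one_GL: "\<one>\<^bsub>GL n\<^esub> = 1\<^sub>m n"
  by (simp add: GL_def units_of_def ring_mat_def)

lemma mem_levi_iff: "g \<in> levi n bs \<longleftrightarrow> g \<in> carrier (GL n) \<and>
    (\<forall>i<n. \<forall>j<n. block_index bs i \<noteq> block_index bs j \<longrightarrow> g $$ (i, j) = 0)"
  by (auto simp: levi_def parabolic_def parabolic_lie_def carrier_GL)

lemma mem_nilradical_iff: "A \<in> nilradical n bs \<longleftrightarrow> A \<in> carrier_mat n n \<and>
    (\<forall>i<n. \<forall>j<n. block_index bs i \<ge> block_index bs j \<longrightarrow> A $$ (i, j) = 0)"
  by (auto simp: nilradical_def parabolic_lie_def le_less)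

lemma index_mult_mat_sum:
  assumes "A \<in> carrier_mat n n" "B \<in> carrier_mat n n" "i < n" "j < n"
  shows "(A * B) $$ (i, j) = (\<Sum>k<n. A $$ (i, k) * B $$ (k, j))"
  using assms by (auto simp: scalar_prod_def lessThan_atLeast0)

lemma levi_inv_closed:
  fixes g :: "'a::field mat"
  assumes g: "g \<in> levi n bs"
  shows "inv\<^bsub>GL n\<^esub> g \<in> levi n bs"
proof -
  interpret group "GL n :: 'a mat monoid" by (rule group_GL)
  define h where "h = inv\<^bsub>GL n\<^esub> g"
  have gG: "g \<in> carrier (GL n)"
    and g0: "\<And>i j. i < n \<Longrightarrow> j < n \<Longrightarrow> block_index bs i \<noteq> block_index bs j \<Longrightarrow> g $$ (i, j) = 0"
    using g by (auto simp: mem_levi_iff)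
  have hG: "h \<in> carrier (GL n)" using gG by (simp add: h_def)
  have gc: "g \<in> carrier_mat n n" and hc: "h \<in> carrier_mat n n"
    using gG hG by (auto dest: carrier_GL)
  have gh: "g * h = 1\<^sub>m n" and hg: "h * g = 1\<^sub>m n"
    using r_inv[OF gG] l_inv[OF gG] by (simp_all add: h_def mult_GL one_GL)
  define h' where
    "h' = mat n n (\<lambda>(i, j). if block_index bs i = block_index bs j then h $$ (i, j) else 0)"
  have h'c: "h' \<in> carrier_mat n n" by (simp add: h'_def)
  have "g * h' = 1\<^sub>m n"
  proof (rule eq_matI)
    fix i j assume "i < dim_row (1\<^sub>m n :: 'a mat)" "j < dim_col (1\<^sub>m n :: 'a mat)"
    then have i: "i < n" and j: "j < n" by auto
    show "(g * h') $$ (i, j) = 1\<^sub>m n $$ (i, j)"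
    proof (cases "block_index bs i = block_index bs j")
      case True
      have "(\<Sum>k<n. g $$ (i, k) * h' $$ (k, j)) = (\<Sum>k<n. g $$ (i, k) * h $$ (k, j))"
        using True g0[OF i] j by (intro sum.cong) (auto simp: h'_def)
      then show ?thesis
        using index_mult_mat_sum[OF gc h'c i j] index_mult_mat_sum[OF gc hc i j] gh by simp
    next
      case False
      have "(\<Sum>k<n. g $$ (i, k) * h' $$ (k, j)) = 0"
        using False g0[OF i] j by (intro sum.neutral) (auto simp: h'_def)
      then show ?thesis
        using index_mult_mat_sum[OF gc h'c i j] False i j by auto
    qed
  qed (use gc h'c in auto)
  then have "h * (g * h') = h" using hc by simp
  moreover have "h * (g * h') = h'"
    using assoc_mult_mat[OF hc gc h'c] hg h'c by simp
  ultimately have "h' = h" by simp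
  have "h $$ (i, j) = 0" if "i < n" "j < n" "block_index bs i \<noteq> block_index bs j" for i j
  proof -
    have "h' $$ (i, j) = 0" using that by (simp add: h'_def)
    then show ?thesis by (simp only: \<open>h' = h\<close>)
  qed
  then show ?thesis using hG by (simp add: mem_levi_iff h_def)
qed

lemma levi_subgroup: "subgroup (levi n bs) (GL n :: 'a::field mat monoid)"
proof -
  interpret group "GL n :: 'a mat monoid" by (rule group_GL)
  show ?thesis
  proof (rule subgroupI)
    show "levi n bs \<subseteq> carrier (GL n :: 'a mat monoid)" by (auto simp: mem_levi_iff)
    have "(1\<^sub>m n :: 'a mat) \<in> carrier (GL n)" using one_closed by (simp only: one_GL)
    then have "(1\<^sub>m n :: 'a mat) \<in> levi n bs" by (auto simp: mem_levi_iff)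
    then show "levi n bs \<noteq> ({} :: 'a mat set)" by auto
  next
    fix g h :: "'a mat" assume g: "g \<in> levi n bs" and h: "h \<in> levi n bs"
    then have c: "g \<in> carrier_mat n n" "h \<in> carrier_mat n n"
      by (auto simp: mem_levi_iff dest: carrier_GL)
    have "g \<otimes>\<^bsub>GL n\<^esub> h \<in> carrier (GL n)" using g h by (auto simp: mem_levi_iff)
    moreover have "(g * h) $$ (i, j) = 0"
      if "i < n" "j < n" "block_index bs i \<noteq> block_index bs j" for i j
      unfolding index_mult_mat_sum[OF c that(1,2)]
    proof (intro sum.neutral ballI)
      fix k assume "k \<in> {..<n}"
      then show "g $$ (i, k) * h $$ (k, j) = 0"
        using g h that by (cases "block_index bs i = block_index bs k") (auto simp: mem_levi_iff)
    qed
    ultimately show "g \<otimes>\<^bsub>GL n\<^esub> h \<in> levi n bs"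
      by (simp add: mem_levi_iff mult_GL)
  qed (rule levi_inv_closed)
qed

lemma levi_nilradical_mult:
  fixes g A :: "'a::field mat"
  assumes g: "g \<in> levi n bs" and A: "A \<in> nilradical n bs"
  shows "g * A \<in> nilradical n bs" "A * g \<in> nilradical n bs"
proof -
  have c: "g \<in> carrier_mat n n" "A \<in> carrier_mat n n"
    using g A by (auto simp: mem_levi_iff mem_nilradical_iff dest: carrier_GL)
  have "(g * A) $$ (i, j) = 0" if "i < n" "j < n" "block_index bs i \<ge> block_index bs j" for i j
    unfolding index_mult_mat_sum[OF c that(1,2)]
  proof (intro sum.neutral ballI)
    fix k assume "k \<in> {..<n}"
    then show "g $$ (i, k) * A $$ (k, j) = 0"
      using g A that by (cases "block_index bs i = block_index bs k")
        (auto simp: mem_levi_iff mem_nilradical_iff)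
  qed
  then show "g * A \<in> nilradical n bs" using c by (auto simp: mem_nilradical_iff)
  have "(A * g) $$ (i, j) = 0" if "i < n" "j < n" "block_index bs i \<ge> block_index bs j" for i j
    unfolding index_mult_mat_sum[OF c(2,1) that(1,2)]
  proof (intro sum.neutral ballI)
    fix k assume "k \<in> {..<n}"
    then show "A $$ (i, k) * g $$ (k, j) = 0"
      using g A that by (cases "block_index bs k = block_index bs j")
        (auto simp: mem_levi_iff mem_nilradical_iff)
  qed
  then show "A * g \<in> nilradical n bs" using c by (auto simp: mem_nilradical_iff)
qed

lemma levi_conj_action:
  "group_action (levi_group n bs) (nilradical n bs :: 'a::field mat set)
     (conj_on n (nilradical n bs))"
proof -
  interpret G: group "GL n :: 'a mat monoid" by (rule group_GL)
  let ?N = "nilradical n bs :: 'a mat set"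
  let ?c = "conj_on n ?N"
  have Lc: "g \<in> carrier (GL n)" "g \<in> carrier_mat n n" if "g \<in> levi n bs" for g :: "'a mat"
    using that by (auto simp: mem_levi_iff dest: carrier_GL)
  have Nc: "A \<in> carrier_mat n n" if "A \<in> ?N" for A
    using that by (simp add: mem_nilradical_iff)
  have closed: "?c g A \<in> ?N" if "g \<in> levi n bs" "A \<in> ?N" for g A
    using that by (simp add: conj_on_def levi_nilradical_mult levi_inv_closed)
  have mult: "?c (g * h) A = ?c g (?c h A)"
    if g: "g \<in> levi n bs" and h: "h \<in> levi n bs" and A: "A \<in> ?N" for g h A
  proof -
    have i: "inv\<^bsub>GL n\<^esub> (g * h) = inv\<^bsub>GL n\<^esub> h * inv\<^bsub>GL n\<^esub> g"
      using G.inv_mult_group[OF Lc(1)[OF g] Lc(1)[OF h]] by (simp add: mult_GL)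
    have c: "inv\<^bsub>GL n\<^esub> g \<in> carrier_mat n n" "inv\<^bsub>GL n\<^esub> h \<in> carrier_mat n n"
      using levi_inv_closed[OF g] levi_inv_closed[OF h] by (auto dest: Lc)
    have "?c (g * h) A = g * h * A * (inv\<^bsub>GL n\<^esub> h * inv\<^bsub>GL n\<^esub> g)"
      using A by (simp add: conj_on_def i)
    also have "\<dots> = g * (h * A * inv\<^bsub>GL n\<^esub> h) * inv\<^bsub>GL n\<^esub> g"
      using Lc(2)[OF g] Lc(2)[OF h] Nc[OF A] c
      by (simp add: assoc_mult_mat[of _ n n _ n _ n])
    also have "\<dots> = ?c g (?c h A)"
      using closed[OF h A] A by (simp add: conj_on_def)
    finally show ?thesis .
  qed
  have one: "?c (1\<^sub>m n) A = A" if A: "A \<in> ?N" for A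
    using A Nc[OF A] G.inv_one by (simp add: conj_on_def one_GL)
  have inverse: "?c (inv\<^bsub>GL n\<^esub> g) (?c g A) = A" "?c g (?c (inv\<^bsub>GL n\<^esub> g) A) = A"
    if g: "g \<in> levi n bs" and A: "A \<in> ?N" for g A
    using mult[OF levi_inv_closed[OF g] g A] mult[OF g levi_inv_closed[OF g] A] one[OF A]
      G.l_inv[OF Lc(1)[OF g]] G.r_inv[OF Lc(1)[OF g]]
    by (simp_all add: mult_GL one_GL)
  have bij: "?c g \<in> Bij ?N" if g: "g \<in> levi n bs" for g
  proof -
    have "bij_betw (?c g) ?N ?N"
      using closed[OF g] closed[OF levi_inv_closed[OF g]] inverse[OF g]
      by (intro bij_betw_byWitness[where f' = "?c (inv\<^bsub>GL n\<^esub> g)"]) auto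
    then show ?thesis by (simp add: Bij_def conj_on_def)
  qed
  have "?c (g * h) = compose ?N (?c g) (?c h)" if "g \<in> levi n bs" "h \<in> levi n bs" for g h
  proof
    fix A
    show "?c (g * h) A = compose ?N (?c g) (?c h) A"
      using mult[OF that, of A] by (cases "A \<in> ?N") (simp_all add: compose_def conj_on_def)
  qed
  then have "?c \<in> hom (levi_group n bs) (BijGroup ?N)"
    using bij by (auto simp: hom_def BijGroup_def mult_GL)
  then show ?thesis
    using G.subgroup_imp_group[OF levi_subgroup] group_BijGroup
    by (simp add: group_action_def group_hom_def group_hom_axioms_def)
qed

end

theory Submission
  imports Defs "Jordan_Normal_Form.Determinant"
begin

text \<open>
  Two matrices \<open>A\<close> and \<open>B\<close> of the nilradical lie in the same orbit iff \<open>g A = B g\<close> for some \<open>g\<close> in the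
  Levi subgroup.

  With at most two blocks, a matrix of the nilradical is a single rectangular block on which the
  Levi subgroup acts by independent row and column operations. Gaussian elimination with full
  pivoting turns the block into a partial permutation matrix, so the orbits are represented by
  the finitely many 0/1 matrices. The elimination is organised by extremality rather than by
  recursion: among all matrices in the orbit one takes a maximal set of pivots, and a nonzero
  entry that is not a pivot would allow one more elimination step
  (\<open>levi_intertwines_eliminate\<close>).

  With at least three blocks, one picks indices \<open>r\<close>, \<open>s\<close>, \<open>t\<close> in three blocks, in this order, and
  looks at the matrices \<open>E\<^sub>r\<^sub>s + E\<^sub>s\<^sub>t + x E\<^sub>r\<^sub>t\<close>. On the three-dimensional space with these coordinates, the
  torus of the Levi subgroup preserves the ratio of the \<open>(r, t)\<close> entry to the product of the two
  others, and an intertwiner of two such matrices is seen entrywise to preserve \<open>x\<close>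
  (\<open>levi_intertwines_triangle\<close>). Algebraically closed fields are infinite, hence so is the number
  of orbits.
\<close>

section \<open>Orbits and intertwiners\<close>

text \<open>
  Clearing the inverse out of \<open>B = g A g\<^sup>-\<^sup>1\<close> makes the condition linear in the entries of \<open>g\<close>, which
  is the form in which orbits are compared below.
\<close>
lemma levi_orbit_eq_iff:
  fixes A B :: "'a::field mat"
  assumes A: "A \<in> nilradical n bs" and B: "B \<in> nilradical n bs"
  defines "orb \<equiv> orbit (levi_group n bs) (conj_on n (nilradical n bs))"
  shows "orb A = orb B \<longleftrightarrow> (\<exists>g\<in>levi n bs. g * A = B * g)"
proof -
  interpret G: group "GL n :: 'a mat monoid" by (rule group_GL)
  interpret act: group_action "levi_group n bs" "nilradical n bs :: 'a mat set"
    "conj_on n (nilradical n bs)"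
    by (rule levi_conj_action)
  have "conj_on n (nilradical n bs) g A = B \<longleftrightarrow> g * A = B * g" if g: "g \<in> levi n bs" for g
  proof -
    define h where "h = inv\<^bsub>GL n\<^esub> g"
    have gG: "g \<in> carrier (GL n)" and hG: "h \<in> carrier (GL n)"
      using g by (auto simp: mem_levi_iff h_def)
    have c: "g \<in> carrier_mat n n" "h \<in> carrier_mat n n" "A \<in> carrier_mat n n" "B \<in> carrier_mat n n"
      using gG hG A B by (auto simp: mem_nilradical_iff dest: carrier_GL)
    have gh: "g * h = 1\<^sub>m n" and hg: "h * g = 1\<^sub>m n"
      using G.r_inv[OF gG] G.l_inv[OF gG] by (simp_all add: h_def mult_GL one_GL)
    have "g * A * h = B \<longleftrightarrow> g * A = B * g"
    proof
      assume "g * A * h = B"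
      then have "B * g = g * A * h * g" by simp
      also have "\<dots> = g * A * (h * g)" using c by (simp add: assoc_mult_mat[of _ n n _ n _ n])
      finally have "B * g = g * A * (h * g)" .
      then show "g * A = B * g" using c hg by simp
    next
      assume "g * A = B * g"
      then have "g * A * h = B * (g * h)" using c by (simp add: assoc_mult_mat[of _ n n _ n _ n])
      then show "g * A * h = B" using c gh by simp
    qed
    then show ?thesis using A by (simp add: conj_on_def h_def)
  qed
  then have "B \<in> orb A \<longleftrightarrow> (\<exists>g\<in>levi n bs. g * A = B * g)"
    by (auto simp: orb_def orbit_def)
  moreover have "orb A = orb B \<longleftrightarrow> B \<in> orb A"
  proof
    assume "orb A = orb B"
    then show "B \<in> orb A" using act.orbit_refl[OF B] by (simp add: orb_def)
  next
    assume *: "B \<in> orb A"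
    have "orb A \<in> orbits (levi_group n bs) (nilradical n bs) (conj_on n (nilradical n bs))"
      "orb B \<in> orbits (levi_group n bs) (nilradical n bs) (conj_on n (nilradical n bs))"
      using A B by (auto simp: orbits_def orb_def)
    then show "orb A = orb B"
      using act.disjoint_union * act.orbit_refl[OF B] unfolding orb_def by blast
  qed
  ultimately show ?thesis by simp
qed

section \<open>At most two blocks: elimination\<close>

text \<open>
  The result of one full elimination step at the pivot \<open>(i, j)\<close>: the cross through the pivot is
  cleared and the pivot becomes 1.
\<close>
definition eliminate :: "nat \<Rightarrow> nat \<Rightarrow> 'a::field mat \<Rightarrow> 'a mat" where
  "eliminate i j A = mat (dim_row A) (dim_col A) (\<lambda>(k, l). if k = i \<and> l = j then 1
     else A $$ (k, l) - A $$ (k, j) * A $$ (i, l) / A $$ (i, j))"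

text \<open>
  In matrix terms this is \<open>(1 + u e\<^sub>i\<^sup>T + e\<^sub>j w\<^sup>T) (1 + u' e\<^sub>i\<^sup>T - e\<^sub>j w\<^sup>T) = 1\<close>. Conjugating
  by the first factor a matrix with a single block, whose rows include \<open>i\<close> and whose columns
  include \<open>j\<close>, adds multiples of row \<open>i\<close> to its rows, as told by \<open>u\<close>, and subtracts multiples of
  column \<open>j\<close> from its columns, as told by \<open>w\<close>: together, an elimination step with the pivot \<open>(i, j)\<close>.
\<close>
lemma mult_elimination_mats:
  fixes u u' w :: "nat \<Rightarrow> 'a::field"
  assumes i: "i < n" and j: "j < n" and ij: "i \<noteq> j"
    and uu': "\<And>k. u k + u' k + u k * u' i = 0"
    and wj: "w j = 0" and wu': "\<And>k. w k * u' k = 0" and wi: "w i = 0"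
  shows "mat n n (\<lambda>(k, m). of_bool (k = m) + of_bool (m = i) * u k + of_bool (k = j) * w m) *
     mat n n (\<lambda>(k, m). of_bool (k = m) + of_bool (m = i) * u' k - of_bool (k = j) * w m) = 1\<^sub>m n"
    (is "?g * ?h = _")
proof (rule eq_matI)
  fix k l assume "k < dim_row (1\<^sub>m n :: 'a mat)" "l < dim_col (1\<^sub>m n :: 'a mat)"
  then have k: "k < n" and l: "l < n" by auto
  have "(?g * ?h) $$ (k, l) = (\<Sum>m<n. ?g $$ (k, m) * ?h $$ (m, l))"
    by (rule index_mult_mat_sum) (use k l in auto)
  also have "\<dots> = (\<Sum>m<n. (if m = k then of_bool (k = l) + of_bool (l = i) * u' k - of_bool (k = j) * w l else 0)
      + (if m = i then u k * (of_bool (i = l) + of_bool (l = i) * u' i) else 0)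
      + (if m = l then of_bool (k = j) * w l else 0))"
    using k l ij wj wu' wi by (intro sum.cong) (auto simp: algebra_simps)
  also have "\<dots> = of_bool (k = l) + of_bool (l = i) * (u k + u' k + u k * u' i)"
    using k l i j by (simp add: sum.distrib sum.delta algebra_simps)
  also have "\<dots> = 1\<^sub>m n $$ (k, l)" using k l uu' by simp
  finally show "(?g * ?h) $$ (k, l) = 1\<^sub>m n $$ (k, l)" .
qed auto

text \<open>
  Row operations scale row \<open>i\<close> by the inverse of the pivot and clear the rest of column \<open>j\<close>; column
  operations clear the rest of row \<open>i\<close>. The former only involve the first block, the latter the
  second, so that one block diagonal matrix performs both.
\<close>
lemma levi_intertwines_eliminate:
  fixes A :: "'a::field mat"
  assumes two: "\<And>i. i < n \<Longrightarrow> block_index bs i \<le> 1"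
    and A: "A \<in> nilradical n bs" and i: "i < n" and j: "j < n" and a: "A $$ (i, j) \<noteq> 0"
  shows "eliminate i j A \<in> nilradical n bs"
    and "\<exists>g\<in>levi n bs. g * A = eliminate i j A * g"
proof -
  define B where "B = eliminate i j A"
  have Ac: "A \<in> carrier_mat n n"
    and A0: "\<And>k l. k < n \<Longrightarrow> l < n \<Longrightarrow> block_index bs k \<ge> block_index bs l \<Longrightarrow> A $$ (k, l) = 0"
    using A by (auto simp: mem_nilradical_iff)
  have bi: "block_index bs i = 0" and bj: "block_index bs j = 1"
    using A0[OF i j] a two[OF i] two[OF j] by linarith+
  have ij: "i \<noteq> j" using bi bj by auto
  have A0': "A $$ (k, l) = 0"
    if "k < n" "l < n" "block_index bs k = 1 \<or> block_index bs l = 0" for k l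
    using A0[OF that(1,2)] that two[OF that(1)] two[OF that(2)] by auto
  have Bc: "B \<in> carrier_mat n n" using Ac by (simp add: B_def eliminate_def)
  have Bkl: "B $$ (k, l) = (if k = i \<and> l = j then 1
     else A $$ (k, l) - A $$ (k, j) * A $$ (i, l) / A $$ (i, j))" if "k < n" "l < n" for k l
    using that Ac by (simp add: B_def eliminate_def)
  have B0: "B $$ (k, l) = 0"
    if "k < n" "l < n" "block_index bs k = 1 \<or> block_index bs l = 0" for k l
    using that Bkl[OF that(1,2)] A0'[OF that] A0'[OF that(1) j] A0'[OF i that(2)] bi bj by auto
  show "eliminate i j A \<in> nilradical n bs"
    unfolding B_def[symmetric] mem_nilradical_iff
  proof (intro conjI allI impI Bc)
    fix k l assume k: "k < n" and l: "l < n" and "block_index bs l \<le> block_index bs k"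
    then show "B $$ (k, l) = 0" using B0[OF k l] two[OF k] two[OF l] by linarith
  qed
  define u where "u k = (if k \<ge> n then 0 else if k = i then 1 / A $$ (i, j) - 1
    else - (A $$ (k, j) / A $$ (i, j)))" for k
  define u' where "u' k = (if k \<ge> n then 0 else if k = i then A $$ (i, j) - 1 else A $$ (k, j))" for k
  define w where "w m = (if m \<ge> n \<or> m = j then 0 else A $$ (i, m) / A $$ (i, j))" for m
  define g where
    "g = mat n n (\<lambda>(k, m). of_bool (k = m) + of_bool (m = i) * u k + of_bool (k = j) * w m)"
  define h where
    "h = mat n n (\<lambda>(k, m). of_bool (k = m) + of_bool (m = i) * u' k - of_bool (k = j) * w m)"
  have u0: "u k = 0" "u' k = 0" if "block_index bs k = 1" for k
    using that A0'[of k j] j bi by (auto simp: u_def u'_def)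
  have w0: "w m = 0" if "block_index bs m = 0" for m
    using that A0'[of i m] i bj by (auto simp: w_def)
  have gc: "g \<in> carrier_mat n n" "h \<in> carrier_mat n n" by (auto simp: g_def h_def)
  have gh: "g * h = 1\<^sub>m n"
    unfolding g_def h_def
  proof (rule mult_elimination_mats[OF i j ij])
    fix k
    show "u k + u' k + u k * u' i = 0" using i a by (simp add: u_def u'_def field_simps)
    show "w k * u' k = 0"
    proof (cases "k < n")
      case True
      then show ?thesis using w0[of k] u0[of k] two[of k] by (cases "block_index bs k = 0") auto
    qed (simp add: w_def)
  qed (use w0 bi in \<open>auto simp: w_def\<close>)
  moreover have "h * g = 1\<^sub>m n" by (rule mat_mult_left_right_inverse[OF gc gh])
  ultimately have "g \<in> carrier (GL n)"
    using gc by (auto simp: GL_def units_of_def Units_def ring_mat_def)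
  moreover have "g $$ (k, m) = 0" if "k < n" "m < n" "block_index bs k \<noteq> block_index bs m" for k m
  proof -
    have "u k = 0 \<or> block_index bs k = 0" using u0 two[OF that(1)] by (auto simp: le_Suc_eq)
    moreover have "w m = 0 \<or> block_index bs m = 1"
      using w0 two[OF that(2)] by (auto simp: le_Suc_eq)
    ultimately show ?thesis using that bi bj by (auto simp: g_def)
  qed
  ultimately have "g \<in> levi n bs" by (simp add: mem_levi_iff)
  moreover have "g * A = B * g"
  proof (rule eq_matI)
    fix k l assume "k < dim_row (B * g)" "l < dim_col (B * g)"
    then have k: "k < n" and l: "l < n" using Bc gc by auto
    have "(g * A) $$ (k, l) = (\<Sum>m<n. g $$ (k, m) * A $$ (m, l))"
      by (rule index_mult_mat_sum[OF gc(1) Ac k l])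
    also have "\<dots> = (\<Sum>m<n. (if m = k then A $$ (k, l) else 0) + (if m = i then u k * A $$ (i, l) else 0))"
    proof (intro sum.cong refl)
      fix m assume "m \<in> {..<n}"
      then have m: "m < n" by simp
      have "w m * A $$ (m, l) = 0"
        using w0[of m] A0'[OF m l] two[OF m] by (cases "block_index bs m = 0") auto
      then show "g $$ (k, m) * A $$ (m, l) =
          (if m = k then A $$ (k, l) else 0) + (if m = i then u k * A $$ (i, l) else 0)"
        using k m ij by (auto simp: g_def algebra_simps)
    qed
    also have "\<dots> = A $$ (k, l) + u k * A $$ (i, l)"
      using i k by (simp add: sum.distrib sum.delta)
    also have "\<dots> = B $$ (k, l) + B $$ (k, j) * w l"
      using k l i j a by (auto simp: Bkl u_def w_def field_simps)
    also have "\<dots> = (\<Sum>m<n. (if m = l then B $$ (k, l) else 0) + (if m = j then B $$ (k, j) * w l else 0))"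
      using j l by (simp add: sum.distrib sum.delta)
    also have "\<dots> = (\<Sum>m<n. B $$ (k, m) * g $$ (m, l))"
    proof (intro sum.cong refl)
      fix m assume "m \<in> {..<n}"
      then have m: "m < n" by simp
      have "B $$ (k, m) * u m = 0"
        using u0[of m] B0[OF k m] two[OF m] by (cases "block_index bs m = 0") auto
      then show "(if m = l then B $$ (k, l) else 0) + (if m = j then B $$ (k, j) * w l else 0)
          = B $$ (k, m) * g $$ (m, l)"
        using l m ij by (auto simp: g_def algebra_simps)
    qed
    also have "\<dots> = (B * g) $$ (k, l)"
      by (rule index_mult_mat_sum[OF Bc gc(1) k l, symmetric])
    finally show "(g * A) $$ (k, l) = (B * g) $$ (k, l)" .
  qed (use Ac Bc gc in auto)
  ultimately show "\<exists>g\<in>levi n bs. g * A = eliminate i j A * g" by (auto simp: B_def)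
qed

definition pivots :: "nat \<Rightarrow> (nat \<times> nat) set \<Rightarrow> 'a::field mat \<Rightarrow> bool" where
  "pivots n S A \<longleftrightarrow> (\<forall>(i, j)\<in>S. A $$ (i, j) = 1 \<and>
     (\<forall>k<n. k \<noteq> i \<longrightarrow> A $$ (k, j) = 0) \<and> (\<forall>l<n. l \<noteq> j \<longrightarrow> A $$ (i, l) = 0))"

text \<open>
  A nonzero entry that is not a pivot shares its row and its column with no pivot. Hence elimination
  there leaves the crosses through the old pivots alone.
\<close>
lemma pivots_eliminate:
  fixes A :: "'a::field mat"
  assumes A: "A \<in> carrier_mat n n" and S: "S \<subseteq> {..<n} \<times> {..<n}" and piv: "pivots n S A"
    and i: "i < n" and j: "j < n" and a: "A $$ (i, j) \<noteq> 0" and new: "(i, j) \<notin> S"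
  shows "pivots n (insert (i, j) S) (eliminate i j A)"
proof -
  have E: "eliminate i j A $$ (k, l) = (if k = i \<and> l = j then 1
     else A $$ (k, l) - A $$ (k, j) * A $$ (i, l) / A $$ (i, j))" if "k < n" "l < n" for k l
    using that A by (simp add: eliminate_def)
  have "eliminate i j A $$ (r, c) = 1 \<and> (\<forall>k<n. k \<noteq> r \<longrightarrow> eliminate i j A $$ (k, c) = 0) \<and>
    (\<forall>l<n. l \<noteq> c \<longrightarrow> eliminate i j A $$ (r, l) = 0)" if rc: "(r, c) \<in> S" for r c
  proof -
    have r: "r < n" and c: "c < n" using rc S by auto
    have 1: "A $$ (r, c) = 1" and col: "\<And>k. k < n \<Longrightarrow> k \<noteq> r \<Longrightarrow> A $$ (k, c) = 0"
      and row: "\<And>l. l < n \<Longrightarrow> l \<noteq> c \<Longrightarrow> A $$ (r, l) = 0"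
      using piv rc by (auto simp: pivots_def)
    have ne: "r \<noteq> i" "c \<noteq> j" using rc new row[OF j] col[OF i] a by auto
    then show ?thesis using 1 col row r c i j by (simp add: E)
  qed
  moreover have "eliminate i j A $$ (i, j) = 1 \<and> (\<forall>k<n. k \<noteq> i \<longrightarrow> eliminate i j A $$ (k, j) = 0) \<and>
    (\<forall>l<n. l \<noteq> j \<longrightarrow> eliminate i j A $$ (i, l) = 0)"
    using i j a by (simp add: E)
  ultimately show ?thesis unfolding pivots_def by blast
qed

text \<open>
  A maximal set \<open>S\<close> of pivots for the matrices of an orbit belongs to a matrix without other nonzero
  entries. This matrix is determined by \<open>S\<close>, so there are at most as many orbits as sets of positions.
\<close>
lemma finite_levi_orbits:
  assumes two: "\<And>i. i < n \<Longrightarrow> block_index bs i \<le> 1"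
  shows "finite (orbits (levi_group n bs) (nilradical n bs :: 'a::field mat set)
    (conj_on n (nilradical n bs)))"
proof -
  let ?N = "nilradical n bs :: 'a mat set"
  let ?orb = "orbit (levi_group n bs) (conj_on n ?N)"
  define M where "M S = mat n n (\<lambda>p. of_bool (p \<in> S) :: 'a)" for S
  have "orbits (levi_group n bs) ?N (conj_on n ?N) \<subseteq> (\<lambda>S. ?orb (M S)) ` Pow ({..<n} \<times> {..<n})"
  proof
    fix O' assume "O' \<in> orbits (levi_group n bs) ?N (conj_on n ?N)"
    then obtain A where A: "A \<in> ?N" and O': "O' = ?orb A" by (auto simp: orbits_def)
    define F where "F = {S \<in> Pow ({..<n} \<times> {..<n}). \<exists>B\<in>?N. ?orb B = ?orb A \<and> pivots n S B}"
    have "{} \<in> F" using A by (auto simp: F_def pivots_def)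
    moreover have "finite F" by (simp add: F_def)
    ultimately obtain S where SF: "S \<in> F" and max: "\<And>T. T \<in> F \<Longrightarrow> S \<subseteq> T \<Longrightarrow> S = T"
      using finite_has_maximal[of F] by (metis empty_iff)
    then obtain B where S: "S \<subseteq> {..<n} \<times> {..<n}" and B: "B \<in> ?N" and BA: "?orb B = ?orb A"
      and piv: "pivots n S B" by (auto simp: F_def)
    have Bc: "B \<in> carrier_mat n n" using B by (simp add: mem_nilradical_iff)
    have "B $$ (i, j) = 0" if i: "i < n" and j: "j < n" and new: "(i, j) \<notin> S" for i j
    proof (rule ccontr)
      assume a: "B $$ (i, j) \<noteq> 0"
      note elim = levi_intertwines_eliminate[OF two B i j a]
      have "?orb (eliminate i j B) = ?orb A"
        using levi_orbit_eq_iff[OF B elim(1)] elim(2) BA by simp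
      then have "insert (i, j) S \<in> F"
        using elim(1) pivots_eliminate[OF Bc S piv i j a new] S i j by (auto simp: F_def)
      then show False using max new by blast
    qed
    moreover have "B $$ (i, j) = 1" if "(i, j) \<in> S" for i j
      using piv that by (auto simp: pivots_def)
    ultimately have "B = M S" using Bc by (intro eq_matI) (auto simp: M_def)
    then show "O' \<in> (\<lambda>S. ?orb (M S)) ` Pow ({..<n} \<times> {..<n})" using O' BA S by auto
  qed
  then show ?thesis by (rule finite_subset) simp
qed

section \<open>At least three blocks: a one-parameter family\<close>

lemma infinite_UNIV_alg_closed: "infinite (UNIV :: 'a::alg_closed_field set)"
proof
  assume fin: "finite (UNIV :: 'a set)"
  \<comment> \<open>Euclid's argument: \<open>p + 1\<close> has no root among the roots of \<open>p\<close>.\<close>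
  define p :: "'a poly" where "p = (\<Prod>a\<in>UNIV. [:-a, 1:])"
  have "degree p = card (UNIV :: 'a set)"
    by (simp add: p_def degree_prod_eq_sum_degree)
  then have "degree (p + 1) > 0" using fin by (simp add: degree_add_eq_left card_gt_0_iff)
  then obtain x where "poly (p + 1) x = 0" using alg_closed_imp_poly_has_root by blast
  moreover have "poly p x = 0" using fin by (auto simp: p_def poly_prod)
  ultimately show False by simp
qed

text \<open>
  This is \<open>E\<^sub>r\<^sub>s + E\<^sub>s\<^sub>t + x E\<^sub>r\<^sub>t\<close>. A diagonal matrix scales the entry at \<open>(r, t)\<close> by the product of its
  factors at \<open>(r, s)\<close> and \<open>(s, t)\<close>, so that keeping the latter two entries equal to 1 keeps \<open>x\<close>.
\<close>
definition triangle :: "nat \<Rightarrow> nat \<Rightarrow> nat \<Rightarrow> nat \<Rightarrow> 'a::field \<Rightarrow> 'a mat" where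
  "triangle n r s t x = mat n n (\<lambda>(i, j). of_bool (i = r \<and> j = s) + of_bool (i = s \<and> j = t)
     + of_bool (i = r \<and> j = t) * x)"

text \<open>
  Entries of \<open>g\<close> between different blocks vanish. Comparing the two products at \<open>(r, s)\<close> and
  \<open>(s, t)\<close> then shows that \<open>g\<close> has the same diagonal entry at \<open>r\<close>, \<open>s\<close> and \<open>t\<close>, and the entry at
  \<open>(r, t)\<close> gives \<open>x = y\<close> once this common value is known to be nonzero.
\<close>
lemma levi_intertwines_triangle:
  fixes g :: "'a::field mat"
  assumes g: "g \<in> levi n bs" and rst: "r < n" "s < n" "t < n"
    and ne: "block_index bs r \<noteq> block_index bs s" "block_index bs s \<noteq> block_index bs t"
      "block_index bs r \<noteq> block_index bs t"
    and eq: "g * triangle n r s t x = triangle n r s t y * g"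
  shows "x = y"
proof -
  interpret G: group "GL n :: 'a mat monoid" by (rule group_GL)
  have gG: "g \<in> carrier (GL n)" using g by (simp add: mem_levi_iff)
  then have gc: "g \<in> carrier_mat n n" by (rule carrier_GL)
  have g0: "g $$ (i, j) = 0" if "i < n" "j < n" "block_index bs i \<noteq> block_index bs j" for i j
    using g that by (simp add: mem_levi_iff)
  have dist: "r \<noteq> s" "s \<noteq> t" "r \<noteq> t" using ne by auto
  have entry: "of_bool (j = s) * g $$ (i, r) + of_bool (j = t) * (g $$ (i, s) + g $$ (i, r) * x)
      = of_bool (i = r) * (g $$ (s, j) + y * g $$ (t, j)) + of_bool (i = s) * g $$ (t, j)"
    if i: "i < n" and j: "j < n" for i j
  proof -
    have "of_bool (j = s) * g $$ (i, r) + of_bool (j = t) * (g $$ (i, s) + g $$ (i, r) * x)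
      = (\<Sum>k<n. (if k = r then g $$ (i, r) * (of_bool (j = s) + of_bool (j = t) * x) else 0)
          + (if k = s then g $$ (i, s) * of_bool (j = t) else 0))"
      using rst by (simp add: sum.distrib sum.delta algebra_simps)
    also have "\<dots> = (\<Sum>k<n. g $$ (i, k) * triangle n r s t x $$ (k, j))"
      using i j dist by (intro sum.cong) (auto simp: triangle_def algebra_simps)
    also have "\<dots> = (g * triangle n r s t x) $$ (i, j)"
      by (rule index_mult_mat_sum[symmetric]) (use gc i j in \<open>auto simp: triangle_def\<close>)
    also have "\<dots> = (\<Sum>k<n. triangle n r s t y $$ (i, k) * g $$ (k, j))"
      unfolding eq by (rule index_mult_mat_sum) (use gc i j in \<open>auto simp: triangle_def\<close>)
    also have "\<dots> = (\<Sum>k<n. (if k = s then of_bool (i = r) * g $$ (s, j) else 0)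
          + (if k = t then (of_bool (i = s) + of_bool (i = r) * y) * g $$ (t, j) else 0))"
      using i j dist by (intro sum.cong) (auto simp: triangle_def algebra_simps)
    also have "\<dots> = of_bool (i = r) * (g $$ (s, j) + y * g $$ (t, j)) + of_bool (i = s) * g $$ (t, j)"
      using rst by (simp add: sum.distrib sum.delta algebra_simps)
    finally show ?thesis .
  qed
  have col: "g $$ (k, r) = 0" if "k < n" "k \<noteq> r" for k
    using entry[OF that(1) rst(2)] that dist g0[OF rst(3,2)] ne by (auto simp: of_bool_def split: if_splits)
  have rs: "g $$ (r, r) = g $$ (s, s)"
    using entry[OF rst(1,2)] dist g0[OF rst(3,2)] ne by simp
  have st: "g $$ (s, s) = g $$ (t, t)"
    using entry[OF rst(2,3)] dist g0[OF rst(2,1)] ne by simp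
  have rt: "g $$ (r, r) * x = y * g $$ (t, t)"
    using entry[OF rst(1,3)] dist g0[OF rst(1,2)] g0[OF rst(2,3)] ne by simp
  \<comment> \<open>Column \<open>r\<close> of \<open>g\<close> has no other nonzero entry, so invertibility forces this one.\<close>
  have "g $$ (r, r) \<noteq> 0"
  proof
    assume "g $$ (r, r) = 0"
    then have colr: "g $$ (k, r) = 0" if "k < n" for k using col[OF that] by (cases "k = r") auto
    let ?h = "inv\<^bsub>GL n\<^esub> g"
    have hc: "?h \<in> carrier_mat n n" using gG by (intro carrier_GL G.inv_closed)
    have "(?h * g) $$ (r, r) = 0"
      using colr by (simp add: index_mult_mat_sum[OF hc gc rst(1,1)])
    moreover have "?h * g = 1\<^sub>m n" using G.l_inv[OF gG] by (simp add: mult_GL one_GL)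
    ultimately show False using rst by simp
  qed
  then show "x = y" using rs st rt by simp
qed

lemma infinite_levi_orbits:
  assumes inf: "infinite (UNIV :: 'a::field set)" and rst: "r < n" "s < n" "t < n"
    and less: "block_index bs r < block_index bs s" "block_index bs s < block_index bs t"
  shows "infinite (orbits (levi_group n bs) (nilradical n bs :: 'a::field mat set)
    (conj_on n (nilradical n bs)))"
proof -
  let ?N = "nilradical n bs :: 'a mat set"
  let ?orb = "\<lambda>x. orbit (levi_group n bs) (conj_on n ?N) (triangle n r s t x)"
  have N: "triangle n r s t x \<in> ?N" for x
    using less by (auto simp: mem_nilradical_iff triangle_def)
  have "inj ?orb"
  proof (rule injI)
    fix x y assume "?orb x = ?orb y"
    then obtain g where "g \<in> levi n bs" "g * triangle n r s t x = triangle n r s t y * g"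
      using levi_orbit_eq_iff[OF N N] by blast
    then show "x = y" using less by (intro levi_intertwines_triangle[OF _ rst]) auto
  qed
  then have "infinite (range ?orb)" using inf finite_imageD by blast
  moreover have "range ?orb \<subseteq> orbits (levi_group n bs) ?N (conj_on n ?N)"
    using N by (auto simp: orbits_def)
  ultimately show ?thesis using finite_subset by blast
qed

section \<open>The classification\<close>

lemma block_index_less_length: "i < sum_list bs \<Longrightarrow> block_index bs i < length bs"
  by (induction bs i rule: block_index.induct) auto

theorem lemma3p6:
  fixes n :: nat and bs :: "nat list"
  assumes "bs \<noteq> []"
    and "\<forall>b \<in> set bs. 1 \<le> b"
    and "sum_list bs = n"
  shows "finite (orbits (levi_group n bs) (nilradical n bs :: 'a::alg_closed_field mat set)
           (conj_on n (nilradical n bs)))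
         \<longleftrightarrow> length bs \<in> {1, 2}"
proof (cases "length bs \<in> {1, 2}")
  case True
  have "block_index bs i \<le> 1" if "i < n" for i
    using True block_index_less_length[of i bs] that assms(3) by auto
  then show ?thesis using True finite_levi_orbits by blast
next
  case False
  moreover have "0 < length bs" using assms(1) by simp
  ultimately have "Suc (Suc (Suc 0)) \<le> length bs" by (simp, linarith)
  then obtain b0 b1 b2 bs' where bs: "bs = b0 # b1 # b2 # bs'"
    by (auto simp: Suc_le_length_iff)
  \<comment> \<open>The first three blocks start at the indices \<open>0\<close>, \<open>b0\<close> and \<open>b0 + b1\<close>.\<close>
  have "infinite (orbits (levi_group n bs) (nilradical n bs :: 'a mat set)
      (conj_on n (nilradical n bs)))"
    by (rule infinite_levi_orbits[OF infinite_UNIV_alg_closed, of 0 n b0 "b0 + b1"])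
      (use assms bs in auto)
  then show ?thesis using False by simp
qed

end
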